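(* For each $\varepsilon>0$, there exists an infinite set $B\subseteq \mathbb{N}^+$ such that $$|B\cap [1,n]|=O(n^{2/3+\varepsilon})\quad \text{ as }n\to \infty,$$ and $\mathsf{d}(A+B)\in \{0,1\}$ for every set $A\subseteq \mathbb{N}^+$ such that $A+B$ admits asymptotic density.
   Context: $\mathbb{N}^+=\{1,2,\ldots\}$. For $S\subseteq \mathbb{N}^+$, the asymptotic density is $\mathsf{d}(S):=\lim_{n\to\infty} |S\cap[1,n]|/n$, provided the limit exists; $S$ "admits asymptotic density" if this limit exists. The sumset is $A+B:=\{x+y: x\in A, y\in B\}$. *)

theory Defs
  imports Complex_Main "HOL-Library.Set_Algebras" "HOL-Library.Landau_Symbols"
begin

(* Sumsets are written with the addition on sets from Set_Algebras. *)

definition counting :: "nat set \<Rightarrow> nat \<Rightarrow> real" where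
  "counting S n = real (card (S \<inter> {1..n}))"

definition admits_asymp_density :: "nat set \<Rightarrow> bool" where
  "admits_asymp_density S \<longleftrightarrow> convergent (\<lambda>n. counting S n / real n)"

(* Unspecified if the limit does not exist. *)
definition asymp_density :: "nat set \<Rightarrow> real" where
  "asymp_density S = lim (\<lambda>n. counting S n / real n)"

end

theory Submission
  imports Defs "HOL-Library.Indicator_Function" "HOL-Number_Theory.Residue_Primitive_Roots"
begin

text \<open>
  Let \<open>g\<close> be a primitive root modulo a prime \<open>p\<close> and \<open>M = p (p - 1)\<close>. The solutions \<open>b\<close> of
  \<open>b \<equiv> g\<^sup>b (mod p)\<close> form a Sidon set modulo \<open>M\<close> with \<open>p - 1\<close> elements (Ruzsa), so two distinct
  translates of it meet in at most one point per period. A second moment computation then shows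
  that its sumset with any \<open>m\<close> elements of \<open>[1, M]\<close> misses at most \<open>p (1 + M / m)\<close> residues
  modulo \<open>M\<close>.

  Let \<open>B\<close> be the union over rapidly growing primes \<open>p\<^sub>k\<close> of the parts of these sets in \<open>[M\<^sub>k, 3 M\<^sub>k)\<close>.
  If \<open>A + B\<close> has density \<open>d > 0\<close>, then, as \<open>B\<close> has very few elements below \<open>M\<^sub>k\<close>, the set \<open>A\<close> must
  have many elements in \<open>[1, M\<^sub>k]\<close>. Hence \<open>A + B\<close> contains almost all of \<open>[2 M\<^sub>k, 3 M\<^sub>k)\<close>, which
  forces \<open>d = 1\<close>. This \<open>B\<close> even has only \<open>O(\<surd>n)\<close> elements up to \<open>n\<close>.
\<close>

section \<open>Ruzsa's Sidon set modulo \<open>p * (p - 1)\<close>\<close>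

lemma cong_imp_eq_in_period:
  fixes x y m c :: nat
  assumes "[x = y] (mod m)" "x \<in> {c..<c + m}" "y \<in> {c..<c + m}"
  shows "x = y"
  using assms
proof (induction x y rule: linorder_wlog)
  case (le x y)
  then have "m dvd y - x"
    by (metis cong_sym cong_altdef_nat)
  moreover have "y - x < m"
    using le by auto
  ultimately show ?case
    using le(1) by (metis diff_is_0_eq dvd_imp_le le_antisym linorder_not_less neq0_conv)
next
  case (sym x y)
  then show ?case by (metis cong_sym)
qed

text \<open>For a primitive root \<open>g\<close> this is the full preimage in \<open>nat\<close> of
  Ruzsa's set modulo \<open>p * (p - 1)\<close>, so it can be cut to any window.\<close>

definition power_fixed :: "nat \<Rightarrow> nat \<Rightarrow> nat set" where
  "power_fixed p g = {b. [b = g ^ b] (mod p)}"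

lemma primroot_power_cong_iff:
  assumes "prime p" "residue_primroot p g"
  shows "[g ^ x = g ^ y] (mod p) \<longleftrightarrow> [x = y] (mod p - 1)"
  using assms order_divides_expdiff[of p g x y]
  by (auto simp: residue_primroot_def totient_prime)

lemma coprime_prime_pred: "prime p \<Longrightarrow> coprime p (p - 1)" for p :: nat
  using coprime_diff_one_right_nat[of p] prime_gt_0_nat[of p] by simp

text \<open>The residue of \<open>x\<close> modulo \<open>p - 1\<close> fixes \<open>g ^ x\<close>
  modulo \<open>p\<close>, hence \<open>x\<close> itself modulo \<open>p\<close>; the coprime moduli
  then combine.\<close>

lemma power_fixed_cong:
  assumes "prime p" "residue_primroot p g"
    and "x \<in> power_fixed p g" "y \<in> power_fixed p g" "[x = y] (mod p - 1)"
  shows "[x = y] (mod p * (p - 1))"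
proof -
  have "[g ^ x = g ^ y] (mod p)"
    using primroot_power_cong_iff[OF assms(1,2)] assms(5) by blast
  then have "[x = y] (mod p)"
    using assms(3,4) unfolding power_fixed_def by (metis cong_sym cong_trans mem_Collect_eq)
  then show ?thesis
    using assms(5) coprime_prime_pred[OF assms(1)] by (rule coprime_cong_mult_nat)
qed

text \<open>Each residue \<open>i\<close> modulo \<open>p - 1\<close> occurs exactly once: such an
  element must be congruent to \<open>g ^ i\<close> modulo \<open>p\<close>, and the Chinese
  remainder theorem leaves one class modulo \<open>p * (p - 1)\<close>.\<close>

lemma card_power_fixed_period:
  assumes p: "prime p" and g: "residue_primroot p g"
  shows "card (power_fixed p g \<inter> {c..<c + p * (p - 1)}) = p - 1"
proof -
  define M where "M = p * (p - 1)"
  have p1: "p > 1" "p - 1 > 0"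
    using prime_gt_1_nat[OF p] by auto
  then have M0: "M > 0"
    by (simp add: M_def)
  have "bij_betw (\<lambda>n. n mod (p - 1)) (power_fixed p g \<inter> {c..<c + M}) {..<p - 1}"
  proof (rule bij_betw_imageI)
    show "inj_on (\<lambda>n. n mod (p - 1)) (power_fixed p g \<inter> {c..<c + M})"
    proof (rule inj_onI)
      fix x y
      assume x: "x \<in> power_fixed p g \<inter> {c..<c + M}" and y: "y \<in> power_fixed p g \<inter> {c..<c + M}"
        and "x mod (p - 1) = y mod (p - 1)"
      then have "[x = y] (mod M)"
        using power_fixed_cong[OF p g] unfolding M_def cong_def by auto
      then show "x = y"
        by (rule cong_imp_eq_in_period) (use x y in auto)
    qed
  next
    have "i \<in> (\<lambda>n. n mod (p - 1)) ` (power_fixed p g \<inter> {c..<c + M})"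
      if i: "i \<in> {..<p - 1}" for i
    proof -
      obtain x where x: "[x = g ^ i] (mod p)" "[x = i] (mod p - 1)"
        using binary_chinese_remainder_nat[OF coprime_prime_pred[OF p]] by blast
      \<comment> \<open>The representative of \<open>x\<close> in the window;
        \<open>(M - 1) * c\<close> plays the role of \<open>- c\<close> modulo \<open>M\<close>,
        avoiding truncated subtraction.\<close>
      define y where "y = c + (x + (M - 1) * c) mod M"
      have "[y = c + (x + (M - 1) * c)] (mod M)"
        unfolding y_def by (intro cong_add) (auto simp: cong_def)
      also have "c + (x + (M - 1) * c) = x + M * c"
        using M0 by (cases M) auto
      also have "[x + M * c = x] (mod M)"
        by (simp add: cong_def)
      finally have yx: "[y = x] (mod M)" .
      have y1: "[y = x] (mod p)" and y2: "[y = x] (mod p - 1)"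
        using yx unfolding M_def by (metis cong_modulus_mult_nat, metis cong_modulus_mult_nat mult.commute)
      have yi: "[y = i] (mod p - 1)"
        using y2 x(2) cong_trans by blast
      have "[g ^ y = g ^ i] (mod p)"
        using primroot_power_cong_iff[OF p g] yi by blast
      then have "[y = g ^ y] (mod p)"
        using y1 x(1) by (metis cong_sym cong_trans)
      moreover have "y mod (p - 1) = i"
        using yi i by (auto simp: cong_def)
      moreover have "y \<in> {c..<c + M}"
        using M0 by (auto simp: y_def)
      ultimately show ?thesis
        unfolding power_fixed_def by blast
    qed
    then show "(\<lambda>n. n mod (p - 1)) ` (power_fixed p g \<inter> {c..<c + M}) = {..<p - 1}"
      using p1 by auto
  qed
  then show ?thesis
    using bij_betw_same_card M_def by fastforce
qed

text \<open>The two conditions on \<open>u\<close> give \<open>h \<equiv> g\<^sup>u (g\<^sup>h - 1)\<close>, which determines \<open>g\<^sup>u\<close> modulo \<open>p\<close>.\<close>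

lemma power_fixed_common_difference:
  assumes p: "prime p" and g: "residue_primroot p g"
    and u: "u \<in> power_fixed p g" "u + h \<in> power_fixed p g"
    and v: "v \<in> power_fixed p g" "v + h \<in> power_fixed p g"
    and h: "\<not> p * (p - 1) dvd h"
  shows "[u = v] (mod p * (p - 1))"
proof -
  have diff: "[int h = int g ^ w * (int g ^ h - 1)] (mod int p)"
    if "w \<in> power_fixed p g" "w + h \<in> power_fixed p g" for w
  proof -
    have "[int (w + h) = int (g ^ (w + h))] (mod int p)" "[int w = int (g ^ w)] (mod int p)"
      using that unfolding cong_int_iff power_fixed_def by auto
    then have "[int (w + h) - int w = int (g ^ (w + h)) - int (g ^ w)] (mod int p)"
      by (rule cong_diff)
    then show ?thesis
      by (simp add: algebra_simps power_add)
  qed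
  \<comment> \<open>Otherwise \<open>diff\<close> gives \<open>p dvd h\<close> and primitivity gives
    \<open>p - 1 dvd h\<close>, against the assumption on \<open>h\<close>. So the factor
    \<open>g ^ h - 1\<close> can be cancelled.\<close>
  have "\<not> int p dvd int g ^ h - 1"
  proof
    assume *: "int p dvd int g ^ h - 1"
    then have "int p dvd int g ^ u * (int g ^ h - 1)"
      by simp
    then have "int p dvd int h"
      using diff[OF u] cong_dvd_iff[of "int h" _ "int p"] cong_0_iff by (metis cong_trans)
    then have "p dvd h"
      by simp
    have "[int (g ^ h) = int (g ^ 0)] (mod int p)"
      using * by (simp add: cong_iff_dvd_diff)
    then have "[g ^ h = g ^ 0] (mod p)"
      by (simp only: cong_int_iff)
    then have "p - 1 dvd h"
      by (simp add: primroot_power_cong_iff[OF p g] cong_0_iff del: power_0)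
    with \<open>p dvd h\<close> have "p * (p - 1) dvd h"
      using coprime_prime_pred[OF p] by (simp add: divides_mult)
    with h show False ..
  qed
  then have cop: "coprime (int g ^ h - 1) (int p)"
    using p by (metis coprime_commute prime_imp_coprime prime_nat_int_transfer)
  have "[int g ^ u * (int g ^ h - 1) = int g ^ v * (int g ^ h - 1)] (mod int p)"
    using diff[OF u] diff[OF v] by (metis cong_sym cong_trans)
  then have "[int (g ^ u) = int (g ^ v)] (mod int p)"
    by (simp add: cong_mult_rcancel[OF cop])
  then have "[g ^ u = g ^ v] (mod p)"
    by (simp only: cong_int_iff)
  then have "[u = v] (mod p - 1)"
    using primroot_power_cong_iff[OF p g] by blast
  then show ?thesis
    using power_fixed_cong[OF p g] u v by blast
qed

section \<open>Second moment bound for uncovered residues\<close>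

text \<open>A Chebyshev argument: \<open>X n\<close> counts the \<open>a\<close> with
  \<open>n \<in> S a\<close> and vanishes at uncovered points, so each of these contributes
  \<open>\<mu>\<^sup>2\<close> to the sum of \<open>(X n - \<mu>)\<^sup>2\<close> over
  \<open>W\<close>. Expanding the square leaves the first moment and the second, which counts
  pairwise intersections.\<close>

lemma uncovered_second_moment:
  fixes S :: "'a \<Rightarrow> 'b set" and \<mu> :: real
  assumes "finite A" "finite W"
    and S: "\<And>a. a \<in> A \<Longrightarrow> S a \<subseteq> W" "\<And>a. a \<in> A \<Longrightarrow> card (S a) = s"
    and inter: "\<And>a b. a \<in> A \<Longrightarrow> b \<in> A \<Longrightarrow> a \<noteq> b \<Longrightarrow> card (S a \<inter> S b) \<le> 1"
  shows "real (card (W - (\<Union>a\<in>A. S a))) * \<mu>\<^sup>2 \<le>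
    real (card A) * real s + (real (card A))\<^sup>2 - 2 * \<mu> * (real (card A) * real s) + \<mu>\<^sup>2 * real (card W)"
proof -
  define X where "X n = (\<Sum>a\<in>A. indicat_real (S a) n)" for n
  have ind: "(\<Sum>n\<in>W. indicat_real T n) = real (card T)" if "T \<subseteq> W" for T :: "'b set"
    using that \<open>finite W\<close> by (simp add: indicator_def sum.If_cases Int_absorb1 Int_absorb2)
  have fst: "(\<Sum>n\<in>W. X n) = real (card A) * real s"
  proof -
    have "(\<Sum>n\<in>W. X n) = (\<Sum>a\<in>A. \<Sum>n\<in>W. indicat_real (S a) n)"
      unfolding X_def by (rule sum.swap)
    also have "\<dots> = (\<Sum>a\<in>A. real s)"
      by (intro sum.cong) (auto simp: ind S)
    finally show ?thesis by simp
  qed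
  have snd: "(\<Sum>n\<in>W. (X n)\<^sup>2) \<le> real (card A) * real s + (real (card A))\<^sup>2"
  proof -
    have "(\<Sum>n\<in>W. (X n)\<^sup>2) = (\<Sum>n\<in>W. \<Sum>a\<in>A. \<Sum>b\<in>A. indicat_real (S a \<inter> S b) n)"
      unfolding X_def power2_eq_square sum_product
      by (simp add: indicator_inter_arith)
    also have "\<dots> = (\<Sum>a\<in>A. \<Sum>b\<in>A. \<Sum>n\<in>W. indicat_real (S a \<inter> S b) n)"
      by (subst sum.swap, rule sum.cong[OF refl], rule sum.swap)
    also have "\<dots> = (\<Sum>a\<in>A. \<Sum>b\<in>A. real (card (S a \<inter> S b)))"
      using S(1) by (intro sum.cong refl ind) blast
    \<comment> \<open>Allowing the extra 1 on the diagonal as well makes the total exactly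
      \<open>card A * s + (card A)\<^sup>2\<close>.\<close>
    also have "\<dots> \<le> (\<Sum>a\<in>A. \<Sum>b\<in>A. (if a = b then real s else 0) + 1)"
    proof (intro sum_mono)
      fix a b assume "a \<in> A" "b \<in> A"
      then show "real (card (S a \<inter> S b)) \<le> (if a = b then real s else 0) + 1"
        using S(2)[of a] inter[of a b] by auto
    qed
    also have "\<dots> = real (card A) * real s + (real (card A))\<^sup>2"
      using \<open>finite A\<close> by (simp add: sum.distrib power2_eq_square algebra_simps)
    finally show ?thesis .
  qed
  let ?C = "W - (\<Union>a\<in>A. S a)"
  have "real (card ?C) * \<mu>\<^sup>2 = (\<Sum>n\<in>?C. (X n - \<mu>)\<^sup>2)"
    by (simp add: X_def indicator_def)
  also have "\<dots> \<le> (\<Sum>n\<in>W. (X n - \<mu>)\<^sup>2)"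
    using \<open>finite W\<close> by (intro sum_mono2) auto
  also have "\<dots> = (\<Sum>n\<in>W. (X n)\<^sup>2) - 2 * \<mu> * (\<Sum>n\<in>W. X n) + \<mu>\<^sup>2 * real (card W)"
    unfolding sum_distrib_left by (simp add: power2_diff sum.distrib sum_subtractf algebra_simps)
  finally show ?thesis
    using fst snd by simp
qed

text \<open>The second moment bound is applied to the translates of Ruzsa's set by the elements of
  \<open>A\<close>. The window is one full period, so each translate has \<open>p - 1\<close>
  elements there, and distinct elements of \<open>A\<close> are incongruent modulo \<open>M\<close>,
  so the Sidon property applies.\<close>

lemma card_uncovered_window:
  fixes A :: "nat set"
  assumes p: "prime p" and g: "residue_primroot p g" and M: "M = p * (p - 1)"
    and A: "A \<subseteq> {1..M}"
  shows "card {n \<in> {2 * M..<3 * M}. \<forall>a\<in>A. n - a \<notin> power_fixed p g} * card A \<le> p * (M + card A)"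
proof (cases "A = {}")
  case False
  define S where "S a = {n \<in> {2 * M..<3 * M}. n - a \<in> power_fixed p g}" for a
  define s where "s = p - 1"
  define m where "m = card A"
  let ?C = "{n \<in> {2 * M..<3 * M}. \<forall>a\<in>A. n - a \<notin> power_fixed p g}"
  have fin: "finite A"
    using A finite_subset by blast
  have p1: "p > 1"
    using prime_gt_1_nat[OF p] .
  have m0: "m > 0"
    using False fin by (auto simp: m_def card_gt_0_iff)
  have card_S: "card (S a) = s" if "a \<in> A" for a
  proof -
    have a: "1 \<le> a" "a \<le> M"
      using that A by auto
    have "bij_betw (\<lambda>n. n - a) (S a) (power_fixed p g \<inter> {2 * M - a..<(2 * M - a) + M})"
      by (rule bij_betwI[where g = "\<lambda>n. n + a"]) (use a in \<open>auto simp: S_def\<close>)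
    then show ?thesis
      using bij_betw_same_card card_power_fixed_period[OF p g, of "2 * M - a"]
      unfolding s_def M[symmetric] by metis
  qed
  \<comment> \<open>A common point \<open>x\<close> of two translates yields the pair
    \<open>x - b\<close>, \<open>x - a\<close> in Ruzsa's set with difference \<open>b - a\<close>,
    and \<open>0 < b - a < M\<close>. Two such pairs agree modulo \<open>M\<close>.\<close>
  have key: "x = y"
    if "a \<in> A" "b \<in> A" "a < b" "x \<in> S a" "x \<in> S b" "y \<in> S a" "y \<in> S b" for a b x y
  proof -
    have ab: "1 \<le> a" "b \<le> M"
      using that A by auto
    have shift: "x - b + (b - a) = x - a" "y - b + (b - a) = y - a"
      using that ab by (auto simp: S_def)
    have "\<not> M dvd b - a"
      using that(3) ab by (auto dest!: dvd_imp_le)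
    moreover have "x - b \<in> power_fixed p g" "x - b + (b - a) \<in> power_fixed p g"
        "y - b \<in> power_fixed p g" "y - b + (b - a) \<in> power_fixed p g"
      unfolding shift using that by (auto simp: S_def)
    ultimately have "[x - b = y - b] (mod M)"
      using power_fixed_common_difference[OF p g] unfolding M[symmetric] by blast
    then have "x - b = y - b"
      by (rule cong_imp_eq_in_period[where c = "2 * M - b"]) (use that ab in \<open>auto simp: S_def\<close>)
    then show ?thesis
      using that ab by (auto simp: S_def)
  qed
  have inter: "card (S a \<inter> S b) \<le> 1" if "a \<in> A" "b \<in> A" "a \<noteq> b" for a b
  proof -
    have eq: "x = y" if "x \<in> S a \<inter> S b" "y \<in> S a \<inter> S b" for x y
      using that key[of a b x y] key[of b a x y] \<open>a \<in> A\<close> \<open>b \<in> A\<close> \<open>a \<noteq> b\<close>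
      by (metis IntE linorder_neqE_nat)
    have "finite (S a \<inter> S b)"
      by (simp add: S_def)
    then show ?thesis
      unfolding One_nat_def by (subst card_le_Suc0_iff_eq) (use eq in blast)+
  qed
  have C: "{2 * M..<3 * M} - (\<Union>a\<in>A. S a) = ?C"
    by (auto simp: S_def)
  have sM: "real M = real p * real s" "real p = real s + 1"
    using p1 by (simp_all add: M s_def of_nat_diff)
  \<comment> \<open>\<open>m / p\<close> is the average number of representations of an element of the window.\<close>
  have "real (card ?C) * (real m / real p)\<^sup>2 \<le>
      real m * real s + (real m)\<^sup>2 - 2 * (real m / real p) * (real m * real s)
      + (real m / real p)\<^sup>2 * real M"
    using uncovered_second_moment[OF fin finite_atLeastLessThan[of "2 * M" "3 * M"],
        of S s "real m / real p", OF _ card_S inter]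
    unfolding C m_def by (simp add: S_def subset_iff)
  \<comment> \<open>With \<open>M = p * s\<close> the two terms in \<open>m / p\<close> add up to
    \<open>- m\<^sup>2 * s / p\<close>; since \<open>p = s + 1\<close>, this cancels all but
    \<open>m\<^sup>2 / p\<close> of \<open>m\<^sup>2\<close>.\<close>
  also have "\<dots> = real m * real s + (real m)\<^sup>2 / real p"
  proof -
    have "real p * (2 * (real m / real p) * (real m * real s)) = 2 * (real m)\<^sup>2 * real s"
      using p1 by (simp add: power2_eq_square)
    moreover have "real p * ((real m / real p)\<^sup>2 * real M) = (real m)\<^sup>2 * real s"
      using p1 by (simp add: power2_eq_square sM(1))
    moreover have "real p * (real m)\<^sup>2 = real s * (real m)\<^sup>2 + (real m)\<^sup>2"
      unfolding sM(2) by (rule distrib_right[THEN trans]) simp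
    moreover have "real p * ((real m)\<^sup>2 / real p) = (real m)\<^sup>2"
      using p1 by simp
    ultimately have "real p * (real m * real s + (real m)\<^sup>2 - 2 * (real m / real p) * (real m * real s)
      + (real m / real p)\<^sup>2 * real M) = real p * (real m * real s + (real m)\<^sup>2 / real p)"
      unfolding distrib_left right_diff_distrib by simp
    then show ?thesis
      using p1 by simp
  qed
  finally have bound: "real (card ?C) * (real m / real p)\<^sup>2 * (real p)\<^sup>2
      \<le> (real m * real s + (real m)\<^sup>2 / real p) * (real p)\<^sup>2"
    by (rule mult_right_mono) simp
  have lhs: "x * (real m / real p)\<^sup>2 * (real p)\<^sup>2 = (x * real m) * real m" for x
    using p1 by (simp add: power_divide power2_eq_square)
  have rhs: "(real m * real s + (real m)\<^sup>2 / real p) * (real p)\<^sup>2 = (real p * (real M + real m)) * real m"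
    using p1 by (simp add: sM(1) power2_eq_square field_simps)
  have "(real (card ?C) * real m) * real m \<le> (real p * (real M + real m)) * real m"
    using bound unfolding lhs rhs .
  then have "real (card ?C) * real m \<le> real p * (real M + real m)"
    using m0 by simp
  then have "real (card ?C * m) \<le> real (p * (M + m))"
    by simp
  then show ?thesis
    unfolding m_def of_nat_le_iff .
qed simp

section \<open>Finite blocks and sparse primes\<close>

text \<open>With \<open>M = p * (p - 1)\<close>, the range \<open>[M, 3 M)\<close> is where
  \<open>n - a\<close> falls for \<open>n\<close> in \<open>[2 M, 3 M)\<close> and \<open>a\<close>
  in \<open>[1, M]\<close>.\<close>

definition block :: "nat \<Rightarrow> nat set" where
  "block p = power_fixed p (SOME g. residue_primroot p g) \<inter> {p * (p - 1)..<3 * (p * (p - 1))}"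

lemma residue_primroot_SOME: "prime p \<Longrightarrow> residue_primroot p (SOME g. residue_primroot p g)"
  by (rule someI_ex, rule prime_primitive_root_exists) (rule prime_gt_1_nat)

lemma card_block:
  assumes "prime p"
  shows "card (block p) = 2 * (p - 1)"
proof -
  define M where "M = p * (p - 1)"
  define R where "R = power_fixed p (SOME g. residue_primroot p g)"
  have period: "card (R \<inter> {c..<c + M}) = p - 1" for c
    unfolding R_def M_def by (rule card_power_fixed_period[OF assms residue_primroot_SOME[OF assms]])
  have "block p = (R \<inter> {M..<M + M}) \<union> (R \<inter> {2 * M..<2 * M + M})"
    unfolding block_def R_def[symmetric] M_def[symmetric] by auto
  also have "card \<dots> = card (R \<inter> {M..<M + M}) + card (R \<inter> {2 * M..<2 * M + M})"
    by (rule card_Un_disjoint) auto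
  finally show ?thesis
    by (simp only: period mult_2)
qed

lemma card_window_not_sumset_block:
  fixes A B :: "nat set"
  assumes p: "prime p" and M: "M = p * (p - 1)" and B: "block p \<subseteq> B"
  shows "card ({2 * M..<3 * M} - (A + B)) * card (A \<inter> {1..M}) \<le> p * (M + card (A \<inter> {1..M}))"
proof -
  let ?R = "power_fixed p (SOME g. residue_primroot p g)"
  have "{2 * M..<3 * M} - (A + B) \<subseteq> {n \<in> {2 * M..<3 * M}. \<forall>a \<in> A \<inter> {1..M}. n - a \<notin> ?R}"
  proof safe
    fix n a
    assume n: "n \<in> {2 * M..<3 * M}" "n \<notin> A + B" and a: "a \<in> A" "a \<in> {1..M}" and "n - a \<in> ?R"
    then have "n - a \<in> block p"
      unfolding block_def M[symmetric] by auto
    then have "a + (n - a) \<in> A + B"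
      using a B by (intro set_plus_intro) auto
    with n a show False
      by auto
  qed
  then have "card ({2 * M..<3 * M} - (A + B)) \<le> card {n \<in> {2 * M..<3 * M}. \<forall>a \<in> A \<inter> {1..M}. n - a \<notin> ?R}"
    by (intro card_mono) auto
  then show ?thesis
    using card_uncovered_window[OF p residue_primroot_SOME[OF p] M, of "A \<inter> {1..M}"]
    by (meson Int_lower2 le_trans mult_le_mono1)
qed

text \<open>The growth condition places everything below \<open>3 * P k * (P k - 1)\<close>, hence
  all blocks up to index \<open>k\<close>, below \<open>P (Suc k) / Suc k\<close>. The unbounded
  factor \<open>Suc k\<close> is what later makes the error terms vanish.\<close>

lemma ex_sparse_primes:
  "\<exists>P :: nat \<Rightarrow> nat. \<forall>k. prime (P k) \<and> P k \<ge> 3 \<and> P (Suc k) \<ge> 3 * P k * (P k - 1) * Suc k \<and> P k < P (Suc k)"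
proof -
  have "\<exists>P :: nat \<Rightarrow> nat. \<forall>k. (prime (P k) \<and> P k \<ge> 3) \<and>
      (P (Suc k) \<ge> 3 * P k * (P k - 1) * Suc k \<and> P k < P (Suc k))"
  proof (rule dependent_nat_choice)
    show "\<exists>x::nat. prime x \<and> 3 \<le> x"
      by (metis bigger_prime less_imp_le)
  next
    fix x n :: nat
    assume "prime x \<and> 3 \<le> x"
    moreover obtain q where "prime q" and q: "q > 3 * x * (x - 1) * Suc n + x"
      using bigger_prime by blast
    moreover have "3 * x * (x - 1) * Suc n \<le> q" "x < q"
      using q by linarith+
    ultimately show "\<exists>y. (prime y \<and> 3 \<le> y) \<and> 3 * x * (x - 1) * Suc n \<le> y \<and> x < y"
      using order_trans less_imp_le by blast
  qed
  then show ?thesis by blast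
qed

section \<open>Elementary estimates for the counting function\<close>

lemma counting_le: "counting S n \<le> real n"
proof -
  have "card (S \<inter> {1..n}) \<le> card {1..n}"
    by (intro card_mono) auto
  then show ?thesis
    by (simp add: counting_def)
qed

text \<open>The point \<open>2 * M\<close> of the window is already counted in
  \<open>counting S (2 * M)\<close>, which costs the 1.\<close>

lemma counting_diff_ge:
  fixes S :: "nat set"
  assumes "M \<ge> 1"
  shows "real M - 1 - real (card ({2 * M..<3 * M} - S)) \<le> counting S (3 * M) - counting S (2 * M)"
proof -
  let ?W = "{2 * M + 1..<3 * M}"
  have "card (S \<inter> {1..2 * M}) + card (S \<inter> ?W) = card ((S \<inter> {1..2 * M}) \<union> (S \<inter> ?W))"
    by (rule card_Un_disjoint[symmetric]) auto
  also have "\<dots> \<le> card (S \<inter> {1..3 * M})"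
    by (intro card_mono) auto
  finally have 1: "card (S \<inter> {1..2 * M}) + card (S \<inter> ?W) \<le> card (S \<inter> {1..3 * M})" .
  have "M - 1 = card ?W"
    by simp
  also have "\<dots> \<le> card ((S \<inter> ?W) \<union> ({2 * M..<3 * M} - S))"
    by (intro card_mono) auto
  also have "\<dots> \<le> card (S \<inter> ?W) + card ({2 * M..<3 * M} - S)"
    by (rule card_Un_le)
  finally show ?thesis
    using 1 assms unfolding counting_def by linarith
qed

section \<open>The set \<open>B\<close> and its growth\<close>

locale sparse_blocks =
  fixes P :: "nat \<Rightarrow> nat"
  assumes prime_P: "prime (P k)" and P_ge_3: "P k \<ge> 3"
    and P_Suc: "P (Suc k) \<ge> 3 * P k * (P k - 1) * Suc k" and P_less: "P k < P (Suc k)"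
begin

definition M :: "nat \<Rightarrow> nat" where "M k = P k * (P k - 1)"

definition B :: "nat set" where "B = (\<Union>k. block (P k))"

lemma strict_mono_P: "strict_mono P"
  by (simp add: strict_mono_Suc_iff P_less)

lemma P_gt: "k < P k"
proof (induction k)
  case 0
  show ?case
    using P_ge_3[of 0] by simp
next
  case (Suc k)
  then show ?case
    using P_less[of k] by simp
qed

lemma mono_M: "j \<le> k \<Longrightarrow> M j \<le> M k"
  unfolding M_def by (intro mult_le_mono diff_le_mono) (simp_all add: strict_mono_P strict_mono_less_eq)

lemma P_le_M: "P k \<le> M k"
  unfolding M_def using P_ge_3[of k] by (cases "P k") auto

lemma M_ge: "2 * M k \<ge> P k * P k"
proof -
  have "P k * P k \<le> P k * (2 * (P k - 1))"
    using P_ge_3[of k] by (intro mult_le_mono) auto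
  then show ?thesis
    by (simp add: M_def algebra_simps)
qed

lemma le_M: "k \<le> M k"
  using P_gt[of k] P_le_M[of k] by linarith

lemma block_bounds: "b \<in> block (P k) \<Longrightarrow> M k \<le> b \<and> b < 3 * M k"
  by (auto simp: block_def M_def)

lemma small_block:
  assumes "j < k" "b \<in> block (P j)"
  shows "b * k \<le> P k"
proof -
  obtain i where i: "k = Suc i" "j \<le> i"
    using assms(1) by (cases k) auto
  have "b \<le> 3 * M i"
    using block_bounds[OF assms(2)] mono_M[OF i(2)] by linarith
  then have "b * k \<le> 3 * M i * k"
    by (rule mult_le_mono1)
  also have "\<dots> \<le> P k"
    using P_Suc[of i] by (simp add: i M_def mult.assoc)
  finally show ?thesis .
qed

text \<open>Blocks of index at least \<open>k\<close> start at \<open>M k\<close> or later, so such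
  a \<open>b\<close> lies in an earlier block.\<close>

lemma B_less_M:
  assumes "b \<in> B" "b < M k"
  shows "b * k \<le> P k"
proof -
  obtain j where j: "b \<in> block (P j)"
    using assms(1) by (auto simp: B_def)
  have "j < k"
    using block_bounds[OF j] assms(2) mono_M[of k j] by linarith
  then show ?thesis
    using small_block j by blast
qed

lemma B_pos: "B \<subseteq> {1..}"
proof
  fix b assume "b \<in> B"
  then obtain j where "b \<in> block (P j)"
    by (auto simp: B_def)
  then show "b \<in> {1..}"
    using block_bounds[of b j] P_le_M[of j] P_ge_3[of j] by auto
qed

lemma infinite_B: "infinite B"
  unfolding infinite_nat_iff_unbounded_le
proof
  fix m
  have "card (block (P m)) > 0"
    using card_block[OF prime_P] P_ge_3[of m] by simp
  then obtain b where "b \<in> block (P m)"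
    by (metis card.empty equals0I less_irrefl)
  then have "b \<in> B" "m \<le> b"
    using block_bounds[of b m] le_M[of m] by (auto simp: B_def)
  then show "\<exists>n\<ge>m. n \<in> B"
    by blast
qed

text \<open>For the last \<open>k\<close> with \<open>M k \<le> n\<close>, the earlier blocks lie in
  \<open>[1, P k]\<close> and block \<open>k\<close> has fewer than \<open>2 * P k\<close> elements,
  while \<open>P k\<close> is of order at most \<open>sqrt n\<close>.\<close>

lemma counting_B_le:
  assumes "n \<ge> 1"
  shows "counting B n \<le> 5 * sqrt (real n)"
proof (cases "n < M 0")
  case True
  have "M 0 \<le> b" if "b \<in> B" for b
    using that block_bounds mono_M[of 0] unfolding B_def by (meson UN_E le0 le_trans)
  then have "B \<inter> {1..n} = {}"
    using True by fastforce
  then show ?thesis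
    by (simp add: counting_def)
next
  case False
  define k where "k = (GREATEST k. M k \<le> n)"
  have bound: "j \<le> n" if "M j \<le> n" for j
    using le_M[of j] that by linarith
  have "M 0 \<le> n"
    using False by simp
  then have k: "M k \<le> n"
    unfolding k_def by (rule GreatestI_nat) (rule bound)
  have k': "j \<le> k" if "M j \<le> n" for j
    unfolding k_def using that by (rule Greatest_le_nat) (rule bound)
  have "B \<inter> {1..n} \<subseteq> {1..P k} \<union> block (P k)"
  proof
    fix b assume b: "b \<in> B \<inter> {1..n}"
    then obtain j where j: "b \<in> block (P j)"
      by (auto simp: B_def)
    then have "j \<le> k"
      using block_bounds[of b j] b by (intro k') auto
    show "b \<in> {1..P k} \<union> block (P k)"
    proof (cases "j = k")
      case False
      then have "j < k"
        using \<open>j \<le> k\<close> by simp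
      moreover from this have "b \<le> b * k"
        by simp
      ultimately have "b \<le> P k"
        using small_block[OF _ j, of k] by linarith
      then show ?thesis
        using b by auto
    qed (use j in auto)
  qed
  then have "card (B \<inter> {1..n}) \<le> card ({1..P k} \<union> block (P k))"
    by (intro card_mono) (auto simp: block_def)
  also have "\<dots> \<le> card {1..P k} + card (block (P k))"
    by (rule card_Un_le)
  also have "\<dots> \<le> 3 * P k"
    by (simp add: card_block[OF prime_P])
  finally have c: "counting B n \<le> 3 * real (P k)"
    by (simp add: counting_def)
  have "real (P k * P k) \<le> real (2 * n)"
    using M_ge[of k] k by (subst of_nat_le_iff) linarith
  \<comment> \<open>From \<open>(P k)\<^sup>2 \<le> 2 * n\<close> the left side is at most
    \<open>18 * n\<close>, below \<open>25 * n\<close>.\<close>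
  then have "(3 * real (P k))\<^sup>2 \<le> (5 * sqrt (real n))\<^sup>2"
    by (simp add: power2_eq_square)
  then have "3 * real (P k) \<le> 5 * sqrt (real n)"
    by (rule power2_le_imp_le) simp
  with c show ?thesis by linarith
qed

section \<open>Density of \<open>A + B\<close>\<close>

text \<open>Since \<open>a \<ge> 1\<close>, a sum up to \<open>M k\<close> only uses
  \<open>b < M k\<close>, hence \<open>b \<le> P k div k\<close>. A positive proportion of sums at
  scale \<open>M k\<close> therefore forces \<open>A\<close> to have at least about
  \<open>k * M k / P k\<close> elements there.\<close>

lemma counting_sumset_le:
  assumes "A \<subseteq> {1..}"
  shows "counting (A + B) (M k) * real k \<le> real (card (A \<inter> {1..M k})) * real (P k)"
proof (cases "k = 0")
  case False
  have "(A + B) \<inter> {1..M k} \<subseteq> (\<lambda>(a, b). a + b) ` ((A \<inter> {1..M k}) \<times> {1..P k div k})"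
  proof
    fix n assume n: "n \<in> (A + B) \<inter> {1..M k}"
    then obtain a b where ab: "n = a + b" "a \<in> A" "b \<in> B"
      by (auto elim: set_plus_elim)
    then have pos: "a \<ge> 1" "b \<ge> 1"
      using assms B_pos by auto
    then have "b * k \<le> P k"
      using n ab by (intro B_less_M) auto
    then have "b \<le> P k div k"
      using False by (simp add: less_eq_div_iff_mult_less_eq)
    then show "n \<in> (\<lambda>(a, b). a + b) ` ((A \<inter> {1..M k}) \<times> {1..P k div k})"
      using n ab pos by (intro image_eqI[of _ _ "(a, b)"]) auto
  qed
  then have "card ((A + B) \<inter> {1..M k}) \<le> card ((A \<inter> {1..M k}) \<times> {1..P k div k})"
    by (rule surj_card_le[rotated]) auto
  then have "card ((A + B) \<inter> {1..M k}) * k \<le> card (A \<inter> {1..M k}) * (P k div k * k)"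
    by (simp add: card_cartesian_product flip: mult.assoc)
  also have "\<dots> \<le> card (A \<inter> {1..M k}) * P k"
    by simp
  finally have "real (card ((A + B) \<inter> {1..M k}) * k) \<le> real (card (A \<inter> {1..M k}) * P k)"
    by (simp only: of_nat_le_iff)
  then show ?thesis
    by (simp add: counting_def)
qed simp

text \<open>The lower bound for \<open>m\<close> turns the uncovered count
  \<open>P k * (M k / m + 1)\<close> into \<open>(P k)\<^sup>2 / (d * k) + P k\<close>. Both terms
  are of order \<open>M k / k\<close>, because \<open>(P k)\<^sup>2 \<le> 2 * M k\<close> and
  \<open>k < P k\<close>.\<close>

lemma window_deficit_le:
  assumes A: "A \<subseteq> {1..}" and d: "d > 0" and k: "k > 0"
    and dens: "counting (A + B) (M k) / real (M k) \<ge> d"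
  shows "real (card ({2 * M k..<3 * M k} - (A + B))) / real (M k) \<le> 2 / real k + 2 / (real k * d)"
proof -
  define m where "m = card (A \<inter> {1..M k})"
  define c where "c = real (card ({2 * M k..<3 * M k} - (A + B)))"
  have P0: "real (P k) > 0" and M0: "real (M k) > 0"
    using P_ge_3[of k] P_le_M[of k] by auto
  have "d * real (M k) * real k \<le> counting (A + B) (M k) * real k"
    using dens M0 by (intro mult_right_mono) (simp_all add: pos_le_divide_eq)
  also have "\<dots> \<le> real m * real (P k)"
    using counting_sumset_le[OF A] by (simp add: m_def)
  finally have m: "d * real (M k) * real k \<le> real m * real (P k)" .
  have "0 < d * real (M k) * real k"
    using d M0 k by simp
  also note m
  finally have m0: "real m > 0"
    by (simp add: zero_less_mult_iff)
  have "c * real m \<le> real (P k) * (real (M k) + real m)"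
  proof -
    have "card ({2 * M k..<3 * M k} - (A + B)) * m \<le> P k * (M k + m)"
      unfolding m_def by (intro card_window_not_sumset_block prime_P) (auto simp: M_def B_def)
    then have "real (card ({2 * M k..<3 * M k} - (A + B)) * m) \<le> real (P k * (M k + m))"
      by (simp only: of_nat_le_iff)
    then show ?thesis
      by (simp add: c_def)
  qed
  then have "c \<le> real (P k) * (real (M k) / real m + 1)"
    using m0 by (simp add: field_simps)
  also have "\<dots> \<le> real (P k) * (real (P k) / (d * real k) + 1)"
    using m m0 d k P0 by (intro mult_left_mono add_right_mono) (simp_all add: field_simps)
  finally have c: "c \<le> (real (P k) * real (P k)) / (d * real k) + real (P k)"
    by (simp add: algebra_simps)
  have PP: "real (P k) * real (P k) \<le> 2 * real (M k)"
    using M_ge[of k] by (metis of_nat_le_iff of_nat_mult of_nat_numeral)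
  have "real k * real (P k) \<le> real (P k) * real (P k)"
    using P_gt[of k] by (intro mult_right_mono) auto
  then have "real (P k) \<le> 2 * real (M k) / real k"
    using PP k by (simp add: field_simps)
  moreover have "(real (P k) * real (P k)) / (d * real k) \<le> (2 * real (M k)) / (d * real k)"
    using PP d by (intro divide_right_mono) auto
  ultimately have "c \<le> (2 / real k + 2 / (real k * d)) * real (M k)"
    using c by (simp add: algebra_simps)
  then show ?thesis
    using M0 by (simp add: c_def field_simps)
qed

text \<open>Writing \<open>f n\<close> for the proportion of \<open>A + B\<close> in
  \<open>[1, n]\<close>, the share of the window between \<open>2 * M k\<close> and
  \<open>3 * M k\<close> is \<open>3 * f (3 * M k) - 2 * f (2 * M k)\<close>, which tends to
  \<open>d\<close>. If \<open>d > 0\<close>, this share is also bounded below by a sequence tending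
  to 1.\<close>

lemma density_sumset:
  assumes A: "A \<subseteq> {1..}" and lim: "(\<lambda>n. counting (A + B) n / real n) \<longlonglongrightarrow> d"
  shows "d \<in> {0, 1}"
proof -
  have "counting (A + B) n / real n \<le> 1" for n
    using counting_le[of "A + B" n] by (cases "n = 0") (simp_all add: divide_le_eq_1)
  then have d1: "d \<le> 1"
    by (intro LIMSEQ_le_const2[OF lim]) blast
  have d0: "d \<ge> 0"
    by (rule LIMSEQ_le_const[OF lim]) (auto simp: counting_def)
  have "1 \<le> d" if "d \<noteq> 0"
  proof -
    have dpos: "d > 0"
      using that d0 by simp
    have c_lim: "filterlim (\<lambda>k. c * M k) sequentially sequentially" if "c > 0" for c
    proof (rule filterlim_at_top_mono[OF filterlim_ident], rule always_eventually, rule allI)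
      show "k \<le> c * M k" for k
        using that le_M[of k] by (intro le_trans[OF le_M[of k]]) simp
    qed
    note L = filterlim_compose[OF lim]
    \<comment> \<open>\<open>d / 2\<close> is a positive bound that the proportions at
      \<open>M k\<close> eventually exceed; it serves as the \<open>d\<close> of
      \<open>window_deficit_le\<close>.\<close>
    have "eventually (\<lambda>k. d / 2 < counting (A + B) (1 * M k) / real (1 * M k)) sequentially"
      by (rule order_tendstoD(1)[OF L[OF c_lim]]) (use dpos in simp_all)
    moreover have "eventually (\<lambda>k. k > (0::nat)) sequentially"
      by (rule eventually_gt_at_top)
    ultimately have ev: "eventually (\<lambda>k. 1 - 1 / real k - (2 / real k + 2 / (real k * (d / 2)))
        \<le> 3 * (counting (A + B) (3 * M k) / real (3 * M k)) - 2 * (counting (A + B) (2 * M k) / real (2 * M k)))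
        sequentially"
    proof eventually_elim
      case (elim k)
      have M1: "M k \<ge> 1"
        using P_ge_3[of k] P_le_M[of k] by linarith
      have "1 / real (M k) \<le> 1 / real k"
        using le_M[of k] elim by (intro divide_left_mono) auto
      moreover have "(real (M k) - 1 - real (card ({2 * M k..<3 * M k} - (A + B)))) / real (M k)
          \<le> (counting (A + B) (3 * M k) - counting (A + B) (2 * M k)) / real (M k)"
        by (intro divide_right_mono counting_diff_ge M1) simp
      moreover have "real (card ({2 * M k..<3 * M k} - (A + B))) / real (M k)
          \<le> 2 / real k + 2 / (real k * (d / 2))"
        using elim dpos by (intro window_deficit_le A) auto
      ultimately show ?case
        using M1 by (simp add: diff_divide_distrib)
    qed
    have lower: "(\<lambda>k. 1 - 1 / real k - (2 / real k + 2 / (real k * (d / 2)))) \<longlonglongrightarrow> 1 - 0 - (0 + 0 * (2 / d))"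
    proof (intro tendsto_diff tendsto_add tendsto_const)
      show "(\<lambda>k. 1 / real k) \<longlonglongrightarrow> 0"
        by (rule lim_1_over_n)
      show "(\<lambda>k. 2 / real k) \<longlonglongrightarrow> 0"
        using tendsto_mult_right[OF lim_1_over_n, of "2::real"] by simp
      show "(\<lambda>k. 2 / (real k * (d / 2))) \<longlonglongrightarrow> 0 * (2 / d)"
        using tendsto_mult_right[OF lim_1_over_n, of "4 / d"] by simp
    qed
    have upper: "(\<lambda>k. 3 * (counting (A + B) (3 * M k) / real (3 * M k))
        - 2 * (counting (A + B) (2 * M k) / real (2 * M k))) \<longlonglongrightarrow> 3 * d - 2 * d"
      by (intro tendsto_diff tendsto_mult tendsto_const L[OF c_lim]) auto
    have "1 - 0 - (0 + 0 * (2 / d)) \<le> 3 * d - 2 * d"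
      using sequentially_bot upper lower ev by (rule tendsto_le)
    then show ?thesis by simp
  qed
  with d1 show ?thesis by force
qed

end

theorem theorem1p10:
  fixes \<epsilon> :: real
  assumes "\<epsilon> > 0"
  shows "\<exists>B :: nat set. B \<subseteq> {1..} \<and> infinite B \<and>
           counting B \<in> O(\<lambda>n. real n powr (2 / 3 + \<epsilon>)) \<and>
           (\<forall>A :: nat set. A \<subseteq> {1..} \<longrightarrow> admits_asymp_density (A + B) \<longrightarrow>
              asymp_density (A + B) \<in> {0, 1})"
proof -
  obtain P where "\<forall>k. prime (P k) \<and> P k \<ge> 3 \<and> P (Suc k) \<ge> 3 * P k * (P k - 1) * Suc k \<and> P k < P (Suc k)"
    using ex_sparse_primes by blast
  then interpret sparse_blocks P
    by unfold_locales auto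
  have "counting B \<in> O(\<lambda>n. real n powr (2 / 3 + \<epsilon>))"
  proof (rule bigoI)
    show "eventually (\<lambda>n. norm (counting B n) \<le> 5 * norm (real n powr (2 / 3 + \<epsilon>))) sequentially"
      using eventually_ge_at_top[of "1::nat"]
    proof eventually_elim
      case (elim n)
      have "sqrt (real n) = real n powr (1 / 2)"
        by (simp add: powr_half_sqrt)
      \<comment> \<open>The exponent 1/2 lies below 2/3, and \<open>n \<ge> 1\<close> makes
        \<open>powr\<close> monotone in the exponent.\<close>
      also have "\<dots> \<le> real n powr (2 / 3 + \<epsilon>)"
        using elim assms by (intro powr_mono) auto
      finally show ?case
        using counting_B_le[OF elim] by (simp add: counting_def)
    qed
  qed
  moreover have "asymp_density (A + B) \<in> {0, 1}" if "A \<subseteq> {1..}" "admits_asymp_density (A + B)" for A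
    using density_sumset[OF that(1)] that(2)
    unfolding admits_asymp_density_def asymp_density_def convergent_LIMSEQ_iff by blast
  ultimately show ?thesis
    using B_pos infinite_B by blast
qed

end
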